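(* For all sufficiently large integers $m$, there exists a graph $G$ with exactly $m$ edges such that $$C(G)\ge (2+\sqrt{8})^{\frac{m}{5}-1}\ge 1.37^m.$$
   Context: Graphs are finite and simple. $C(G)$ denotes the number of cycles in the graph $G$ (as subgraphs). *)

theory Defs
  imports Complex_Main
begin

type_synonym 'a graph = "'a set \<times> 'a set set"

abbreviation verts :: "'a graph \<Rightarrow> 'a set" where
  "verts G \<equiv> fst G"

abbreviation edges :: "'a graph \<Rightarrow> 'a set set" where
  "edges G \<equiv> snd G"

definition fin_simple_graph :: "'a graph \<Rightarrow> bool" where
  "fin_simple_graph G \<longleftrightarrow>
     finite (verts G) \<and> (\<forall>e\<in>edges G. e \<subseteq> verts G \<and> card e = 2)"

definition subgraph :: "'a graph \<Rightarrow> 'a graph \<Rightarrow> bool" where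
  "subgraph H G \<longleftrightarrow>
     fin_simple_graph H \<and> verts H \<subseteq> verts G \<and> edges H \<subseteq> edges G"

definition is_cycle :: "'a graph \<Rightarrow> bool" where
  "is_cycle H \<longleftrightarrow>
     (\<exists>vs. distinct vs \<and> 3 \<le> length vs \<and> verts H = set vs \<and>
           edges H = {{vs ! i, vs ! (Suc i mod length vs)} | i. i < length vs})"

text \<open>Cycles are counted as subgraphs, so the vertex sequences that differ only by
  rotation or reversal contribute one cycle.\<close>

definition num_cycles :: "'a graph \<Rightarrow> nat" where
  "num_cycles G = card {H. subgraph H G \<and> is_cycle H}"

end

theory Submission
  imports Defs
begin

text \<open>Take layers \<open>{2i, 2i+1}\<close> for \<open>1 \<le> i \<le> k\<close>, join any two vertices in the same
  or in consecutive layers, and join a hub \<open>0\<close> to the first and the last layer; this gives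
  \<open>5k\<close> edges. A path that descends from layer \<open>k\<close> to layer \<open>1\<close> may leave a layer
  after visiting one or both of its vertices, or it may visit two consecutive layers in zigzag order.
  The number of such paths satisfies \<open>f (k + 2) = 4 f (k + 1) + 4 f k\<close>, whose dominant
  characteristic root is \<open>2 + sqrt 8\<close>, and each path closes up through the hub to a different
  cycle. Up to four pendant edges at the hub adjust the number of edges.\<close>

section \<open>Cycles given by vertex sequences\<close>

definition cycle_edges :: "'a list \<Rightarrow> 'a set set" where
  "cycle_edges vs = {{vs ! i, vs ! (Suc i mod length vs)} | i. i < length vs}"

lemma cycle_edges_Cons_subset:
  assumes "p \<noteq> []" "successively (\<lambda>x y. {x, y} \<in> E) p" "{z, hd p} \<in> E" "{z, last p} \<in> E"
  shows "cycle_edges (z # p) \<subseteq> E"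
proof
  fix e assume "e \<in> cycle_edges (z # p)"
  then obtain i where i: "i < length (z # p)"
    "e = {(z # p) ! i, (z # p) ! (Suc i mod length (z # p))}"
    by (auto simp: cycle_edges_def)
  have succ: "{p ! j, p ! Suc j} \<in> E" if "Suc j < length p" for j
    using assms(2) that by (simp add: successively_conv_nth)
  consider "i = 0" | j where "i = Suc j" "Suc j < length p" | "i = length p"
    using i(1) by (cases i) (auto simp: less_Suc_eq)
  then show "e \<in> E"
  proof cases
    case 1
    with assms i show ?thesis by (simp add: hd_conv_nth)
  next
    case 2
    with i succ[of j] show ?thesis by simp
  next
    case 3
    with assms i show ?thesis
      by (simp add: last_conv_nth nth_Cons' insert_commute)
  qed
qed

text \<open>The edge set fixes a cyclic sequence up to rotation and reversal. The common start
  excludes rotation, and \<open>orient\<close> excludes reversal. Walking along \<open>xs\<close>,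
  each edge at \<open>ys ! h\<close> leads to one of the two neighbours of that vertex in
  \<open>ys\<close>, and only the successor is possible.\<close>

lemma cycle_edges_inj:
  assumes "distinct xs" "distinct ys" and len: "length xs = length ys" "2 \<le> length xs"
    and eq: "cycle_edges xs = cycle_edges ys"
    and hd: "xs ! 0 = ys ! 0" and orient: "xs ! 1 \<noteq> last ys"
  shows "xs = ys"
proof (rule nth_equalityI)
  fix i assume "i < length xs"
  then show "xs ! i = ys ! i"
  proof (induction i rule: less_induct)
    case (less i)
    show ?case
    proof (cases i)
      case 0
      with hd show ?thesis by simp
    next
      case (Suc h)
      have h: "xs ! h = ys ! h" "h < length ys" "Suc h < length ys"
        using less Suc len by auto
      have "{xs ! h, xs ! Suc h} \<in> cycle_edges xs"
        unfolding cycle_edges_def using h len by (auto intro!: exI[of _ h])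
      then obtain j where j: "j < length ys"
        "{xs ! h, xs ! Suc h} = {ys ! j, ys ! (Suc j mod length ys)}"
        unfolding eq by (auto simp: cycle_edges_def)
      have ne: "xs ! h \<noteq> xs ! Suc h"
        using nth_eq_iff_index_eq[OF assms(1), of h "Suc h"] h(2,3) len by simp
      show ?thesis
      proof (cases "ys ! j = ys ! h")
        case True
        then have "j = h" using assms(2) h j(1) by (simp add: nth_eq_iff_index_eq)
        with j(2) h ne Suc show ?thesis by (auto simp: doubleton_eq_iff)
      next
        \<comment> \<open>Here \<open>xs\<close> would step from \<open>ys ! h\<close> to its
          predecessor in \<open>ys\<close>. For \<open>h = 0\<close> this is \<open>last ys\<close>,
          against \<open>orient\<close>; for \<open>h > 0\<close> it is, by induction, a vertex that
          \<open>xs\<close> has already visited.\<close>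
        case False
        then have *: "ys ! (Suc j mod length ys) = ys ! h" "xs ! Suc h = ys ! j"
          using j(2) h by (auto simp: doubleton_eq_iff)
        have "Suc j mod length ys < length ys" using h by (intro mod_less_divisor) auto
        then have jh: "Suc j mod length ys = h"
          using * h assms(2) by (simp add: nth_eq_iff_index_eq)
        show ?thesis
        proof (cases "Suc j = length ys")
          case True
          have "h = 0"
            using jh True by simp
          moreover have "last ys = ys ! j"
            using True by (metis diff_Suc_1 last_conv_nth list.size(3) nat.distinct(1))
          ultimately show ?thesis using * orient by simp
        next
          case False
          then have "h = Suc j" using jh j(1) by simp
          then have "xs ! Suc h = xs ! j"
            using * less.IH[of j] Suc less.prems by simp
          with assms(1) h len \<open>h = Suc j\<close> show ?thesis
            by (simp add: nth_eq_iff_index_eq)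
        qed
      qed
    qed
  qed
qed (use len in simp)

text \<open>A lower bound on the number of cycles follows from a set of closed sequences, provided
  that no two of them describe the same subgraph.\<close>

lemma card_le_num_cycles:
  assumes "fin_simple_graph G" "inj_on (\<lambda>vs. (set vs, cycle_edges vs)) P"
    and "\<And>vs. vs \<in> P \<Longrightarrow>
      distinct vs \<and> 3 \<le> length vs \<and> set vs \<subseteq> verts G \<and> cycle_edges vs \<subseteq> edges G"
  shows "card P \<le> num_cycles G"
proof -
  let ?C = "{H. subgraph H G \<and> is_cycle H}" and ?f = "\<lambda>vs. (set vs, cycle_edges vs)"
  have "?f ` P \<subseteq> ?C"
  proof
    fix H assume "H \<in> ?f ` P"
    then obtain vs where vs: "vs \<in> P" "H = ?f vs" by auto
    have "\<forall>e\<in>cycle_edges vs. e \<subseteq> set vs"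
      by (auto simp: cycle_edges_def intro!: nth_mem mod_less_divisor)
    moreover have "\<forall>e\<in>cycle_edges vs. card e = 2"
      using assms(1,3) vs(1) by (auto simp: fin_simple_graph_def)
    ultimately have "subgraph H G"
      using assms(3)[OF vs(1)] vs(2) by (auto simp: subgraph_def fin_simple_graph_def)
    moreover have "is_cycle H"
      using assms(3)[OF vs(1)] vs(2) unfolding is_cycle_def cycle_edges_def by auto
    ultimately show "H \<in> ?C" by simp
  qed
  \<comment> \<open>Without finiteness, \<open>card ?C\<close> could be the default value 0 and
    \<open>card_mono\<close> would fail.\<close>
  moreover have "finite ?C"
  proof (rule finite_subset)
    show "?C \<subseteq> Pow (verts G) \<times> Pow (edges G)"
      by (auto simp: subgraph_def)
    have "edges G \<subseteq> Pow (verts G)"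
      using assms(1) by (auto simp: fin_simple_graph_def)
    with assms(1) show "finite (Pow (verts G) \<times> Pow (edges G))"
      by (auto simp: fin_simple_graph_def intro: finite_subset)
  qed
  ultimately have "card (?f ` P) \<le> card ?C" by (intro card_mono)
  with assms(2) show ?thesis
    by (simp add: num_cycles_def card_image)
qed

section \<open>The ladder graph\<close>

text \<open>The hub 0 is joined to the first layer only. Its edges to the last layer are left to
  \<open>hub_ladder\<close>, so that the sets grow with \<open>k\<close> and induction
  applies.\<close>

fun ladder :: "nat \<Rightarrow> nat set set" where
  "ladder 0 = {}"
| "ladder (Suc 0) = {{0, 2}, {0, 3}, {2, 3}}"
| "ladder (Suc (Suc k)) = ladder (Suc k) \<union>
     {{2*k+4, 2*k+5}, {2*k+4, 2*k+2}, {2*k+4, 2*k+3}, {2*k+5, 2*k+2}, {2*k+5, 2*k+3}}"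

lemma ladder_edge:
  "e \<in> ladder k \<Longrightarrow> e \<subseteq> {..2*k+1} \<and> card e = 2"
  by (induction k rule: ladder.induct) fastforce+

lemma finite_ladder: "finite (ladder k)"
  by (induction k rule: ladder.induct) auto

lemma card_ladder: "card (ladder (Suc k)) = 5 * k + 3"
proof (induction k)
  case 0
  show ?case by (simp add: doubleton_eq_iff)
next
  case (Suc k)
  let ?N = "{{2*k+4, 2*k+5}, {2*k+4, 2*k+2}, {2*k+4, 2*k+3}, {2*k+5, 2*k+2}, {2*k+5, 2*k+3::nat}}"
  have "ladder (Suc k) \<inter> ?N = {}"
    using ladder_edge[of _ "Suc k"] by fastforce
  moreover have "card ?N = 5"
    by (simp add: doubleton_eq_iff)
  ultimately have "card (ladder (Suc k) \<union> ?N) = 5 * k + 3 + 5"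
    by (subst card_Un_disjoint) (simp_all only: Suc finite_ladder finite.intros)
  then show ?case by simp
qed

lemma ladder_Suc_mono: "ladder k \<subseteq> ladder (Suc k)"
  by (cases k) auto

lemma ladder_first_layer: "{0, 2} \<in> ladder (Suc k) \<and> {0, 3} \<in> ladder (Suc k)"
  by (induction k) auto

section \<open>Descending paths\<close>

text \<open>The prefixes of length 4 are the zigzags: they alternate between two layers, start in
  the upper one and end in the lower one. The empty path for \<open>k = 0\<close> is what remains
  after a zigzag through the last two layers.\<close>

fun descents :: "nat \<Rightarrow> nat list set" where
  "descents 0 = {[]}"
| "descents (Suc 0) = {[2], [3], [2, 3], [3, 2]}"
| "descents (Suc (Suc k)) =
     (\<Union>w \<in> {[2*k+4], [2*k+5], [2*k+4, 2*k+5], [2*k+5, 2*k+4]}. (@) w ` descents (Suc k)) \<union>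
     (\<Union>w \<in> {[2*k+4, 2*k+2, 2*k+5, 2*k+3], [2*k+4, 2*k+3, 2*k+5, 2*k+2],
             [2*k+5, 2*k+2, 2*k+4, 2*k+3], [2*k+5, 2*k+3, 2*k+4, 2*k+2]}. (@) w ` descents k)"

lemma finite_descents: "finite (descents k)"
  by (induction k rule: induct_nat_012) auto

lemma set_descents: "p \<in> descents k \<Longrightarrow> set p \<subseteq> {2..2*k+1}"
  by (induction k arbitrary: p rule: induct_nat_012) fastforce+

lemma distinct_descents: "p \<in> descents k \<Longrightarrow> distinct p"
proof (induction k arbitrary: p rule: induct_nat_012)
  case (ge2 k)
  then show ?case
    using set_descents[of _ "Suc k"] set_descents[of _ k] by fastforce
qed auto

lemma length_descents: "p \<in> descents k \<Longrightarrow> k \<le> length p"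
  by (induction k arbitrary: p rule: induct_nat_012) fastforce+

lemma hd_descents: "p \<in> descents (Suc k) \<Longrightarrow> p \<noteq> [] \<and> hd p \<in> {2*k+2, 2*k+3}"
  by (cases k) auto

lemma last_descents: "p \<in> descents (Suc k) \<Longrightarrow> last p \<in> {2, 3}"
proof (induction k arbitrary: p rule: less_induct)
  case (less k)
  \<comment> \<open>With two layers a zigzag may leave the empty remainder, so its own last vertex
    counts. From three layers on the remainder is nonempty and determines
    \<open>last p\<close>.\<close>
  consider "k = 0" | "k = Suc 0" | l where "k = Suc (Suc l)"
    by (metis not0_implies_Suc)
  then show ?case
  proof cases
    case 1
    with less.prems show ?thesis by auto
  next
    case 2
    with less.prems show ?thesis by auto
  next
    case 3
    obtain w q where "p = w @ q" "q \<in> descents (Suc (Suc l)) \<or> q \<in> descents (Suc l)"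
      using less.prems unfolding 3 descents.simps(3)[of "Suc l"] by blast
    with 3 less.IH[of "Suc l"] less.IH[of l] hd_descents[of q "Suc l"] hd_descents[of q l]
    show ?thesis by (metis last_appendR lessI less_SucI)
  qed
qed

lemma ladder_consecutive:
  assumes "x \<in> {2*k+4, 2*k+5}" "y \<in> {2*k+2, 2*k+3}"
  shows "{x, y} \<in> ladder (Suc (Suc k))" "{y, x} \<in> ladder (Suc (Suc k))"
  using assms by (auto simp: insert_commute)

lemma successively_descents:
  "p \<in> descents k \<Longrightarrow> successively (\<lambda>x y. {x, y} \<in> ladder k) p"
proof (induction k arbitrary: p rule: induct_nat_012)
  case (ge2 k)
  define R where "R = (\<lambda>x y. {x, y} \<in> ladder (Suc (Suc k)))"
  have mono1: "successively R q" if "q \<in> descents (Suc k)" for q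
    using ge2(2)[OF that] by (rule successively_mono) (auto simp: R_def)
  have mono2: "successively R q" if "q \<in> descents k" for q
    using ge2(1)[OF that] unfolding R_def
    by (rule successively_mono) (use ladder_Suc_mono[of k] ladder_Suc_mono[of "Suc k"] in blast)
  have adj: "R x y" "R y x" if "x \<in> {2*k+4, 2*k+5}" "y \<in> {2*k+2, 2*k+3}" for x y
    using ladder_consecutive[OF that] by (simp_all add: R_def)
  have same: "R (2*k+4) (2*k+5)"
    by (simp add: R_def)
  then have same': "R (2*k+5) (2*k+4)"
    by (simp only: R_def insert_commute)
  consider w q where "p = w @ q" "q \<in> descents (Suc k)"
      "w \<in> {[2*k+4], [2*k+5], [2*k+4, 2*k+5], [2*k+5, 2*k+4]}"
    | w q where "p = w @ q" "q \<in> descents k"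
      "w \<in> {[2*k+4, 2*k+2, 2*k+5, 2*k+3], [2*k+4, 2*k+3, 2*k+5, 2*k+2],
             [2*k+5, 2*k+2, 2*k+4, 2*k+3], [2*k+5, 2*k+3, 2*k+4, 2*k+2]}"
    using ge2(3) unfolding descents.simps(3) by blast
  then have "successively R p"
  proof cases
    case 1
    have "successively R w" "w \<noteq> []" "last w \<in> {2*k+4, 2*k+5}"
      using 1(3) same same' by auto
    moreover have "hd q \<in> {2*k+2, 2*k+3}"
      using hd_descents[OF 1(2)] by simp
    ultimately show ?thesis
      using 1(1) mono1[OF 1(2)] adj(1) by (metis successively_append_iff)
  next
    case 2
    have "successively R w" "w \<noteq> []" "last w \<in> {2*k+2, 2*k+3}"
      using 2(3) adj by auto
    \<comment> \<open>The zigzag ends one layer above the remainder, so the joining edge already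
      lies in \<open>ladder (Suc k)\<close>.\<close>
    moreover have "R (last w) (hd q)" if "q \<noteq> []"
    proof (cases k)
      case 0
      with 2(2) that show ?thesis by simp
    next
      case (Suc l)
      have "hd q \<in> {2*l+2, 2*l+3}"
        using hd_descents 2(2) Suc by blast
      moreover have "last w \<in> {2*l+4, 2*l+5}"
        using \<open>last w \<in> _\<close> Suc by auto
      ultimately show ?thesis
        using ladder_consecutive(1) ladder_Suc_mono[of "Suc k"] unfolding R_def Suc by blast
    qed
    ultimately show ?thesis
      using 2(1) mono2[OF 2(2)] by (metis successively_append_iff)
  qed
  then show ?case by (simp only: R_def)
qed (auto simp: insert_commute)

section \<open>Counting the descending paths\<close>

text \<open>As all prefixes have the same length, the prefix can be read off from the concatenation,
  so the images are disjoint.\<close>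

lemma card_Union_append:
  assumes "finite W" "finite P" "\<And>w. w \<in> W \<Longrightarrow> length w = n"
  shows "card (\<Union>w\<in>W. (@) w ` P) = card W * card P"
proof -
  have "card (\<Union>w\<in>W. (@) w ` P) = (\<Sum>w\<in>W. card ((@) w ` P))"
    using assms by (intro card_UN_disjoint) auto
  also have "\<dots> = card W * card P"
    by (simp add: card_image inj_on_def)
  finally show ?thesis .
qed

lemma card_descents:
  "card (descents (Suc (Suc k))) = 4 * card (descents (Suc k)) + 4 * card (descents k)"
proof -
  let ?a = "2*k+4" and ?b = "2*k+5" and ?c = "2*k+2" and ?d = "2*k+3"
  define A where "A = (\<Union>w \<in> {[?a], [?b]}. (@) w ` descents (Suc k))"
  define B where "B = (\<Union>w \<in> {[?a, ?b], [?b, ?a]}. (@) w ` descents (Suc k))"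
  define C where "C = (\<Union>w \<in> {[?a, ?c, ?b, ?d], [?a, ?d, ?b, ?c], [?b, ?c, ?a, ?d], [?b, ?d, ?a, ?c]}.
    (@) w ` descents k)"
  have "finite A" "finite B" "finite C"
    by (simp_all add: A_def B_def C_def finite_descents)
  moreover have "card A = 2 * card (descents (Suc k))"
    unfolding A_def by (subst card_Union_append[where n = 1]) (auto simp: finite_descents)
  moreover have "card B = 2 * card (descents (Suc k))"
    unfolding B_def by (subst card_Union_append[where n = 2]) (auto simp: finite_descents)
  moreover have "card C = 4 * card (descents k)"
    unfolding C_def by (subst card_Union_append[where n = 4]) (auto simp: finite_descents)
  moreover have not_in: "?a \<notin> set p" "?b \<notin> set p" if "p \<in> descents (Suc k)" for p
    using set_descents[OF that] by auto
  \<comment> \<open>Paths in \<open>A\<close> contain one top vertex, while those in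
    \<open>B\<close> and \<open>C\<close> contain both: in \<open>B\<close> side by side, in
    \<open>C\<close> separated by a vertex of the layer below.\<close>
  have "A \<inter> B = {}" "(A \<union> B) \<inter> C = {}"
    using not_in by (force simp: A_def B_def C_def)+
  moreover have "descents (Suc (Suc k)) = (A \<union> B) \<union> C"
    by (auto simp: A_def B_def C_def)
  ultimately show ?thesis
    by (simp add: card_Un_disjoint del: descents.simps)
qed

text \<open>The number \<open>2 + sqrt 8\<close> is a root of \<open>x^2 = 4 * x + 4\<close>, so the
  bound satisfies the same recurrence as the count and only the two initial values remain.\<close>

lemma card_descents_ge: "4 * (2 + sqrt 8) ^ k \<le> real (card (descents (Suc k)))"
proof (induction k rule: induct_nat_012)
  case 1
  \<comment> \<open>There are \<open>4 * 4 + 4 * 1 = 20\<close> paths for two layers, so the claim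
    amounts to \<open>sqrt 8 \<le> 3\<close>.\<close>
  have "sqrt 8 \<le> 3" by (rule real_le_lsqrt) auto
  then show ?case
    using card_descents[of 0] by simp
next
  case (ge2 n)
  have "(2 + sqrt 8) ^ 2 = 4 * (2 + sqrt 8) + 4"
    by (simp add: power2_eq_square algebra_simps)
  then have "4 * (2 + sqrt 8) ^ Suc (Suc n) = (2 + sqrt 8) ^ n * 4 * (4 * (2 + sqrt 8) + 4)"
    by (simp add: power2_eq_square)
  also have "\<dots> = 4 * (4 * (2 + sqrt 8) ^ Suc n) + 4 * (4 * (2 + sqrt 8) ^ n)"
    by (simp add: algebra_simps)
  finally show ?case
    using ge2 card_descents[of "Suc n"] by simp
qed simp

section \<open>Closing the paths through the hub\<close>

text \<open>The interval consists of the last layer \<open>2*k\<close>, \<open>2*k+1\<close> and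
  \<open>r\<close> further vertices, which become the pendant neighbours of the hub.\<close>

definition hub_ladder :: "nat \<Rightarrow> nat \<Rightarrow> nat graph" where
  "hub_ladder k r = ({..2*k+1+r}, ladder k \<union> (\<lambda>v. {0, v}) ` {2*k..2*k+1+r})"

lemma fin_simple_graph_hub_ladder:
  assumes "0 < k"
  shows "fin_simple_graph (hub_ladder k r)"
  using assms ladder_edge[of _ k] by (fastforce simp: fin_simple_graph_def hub_ladder_def)

text \<open>This separates the old hub edges from the added ones, which for \<open>k \<ge> 2\<close>
  end at vertices from 4 on.\<close>

lemma ladder_hub_edge: "{0, v} \<in> ladder k \<Longrightarrow> v \<le> 3"
  by (induction k rule: ladder.induct) (auto simp: doubleton_eq_iff)

lemma card_edges_hub_ladder:
  assumes "2 \<le> k"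
  shows "card (edges (hub_ladder k r)) = 5 * k + r"
proof -
  have "card (ladder k) = 5 * k - 2"
    using assms card_ladder[of "k - 1"] by (cases k) auto
  moreover have "card ((\<lambda>v. {0, v}) ` {2*k..2*k+1+r}) = r + 2"
    by (subst card_image) (auto simp: inj_on_def doubleton_eq_iff)
  moreover have "ladder k \<inter> (\<lambda>v. {0, v}) ` {2*k..2*k+1+r} = {}"
    using assms ladder_hub_edge[of _ k] by fastforce
  ultimately show ?thesis
    using assms by (simp add: hub_ladder_def card_Un_disjoint finite_ladder)
qed

lemma num_cycles_hub_ladder:
  assumes "2 \<le> k"
  shows "card (descents k) \<le> num_cycles (hub_ladder k r)"
proof -
  obtain l where l: "k = Suc l" "0 < l" using assms by (cases k) auto
  have hd: "p \<noteq> []" "hd p \<in> {2*k, 2*k+1}" and last: "last p \<in> {2, 3}"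
    if "p \<in> descents k" for p
    using hd_descents[of p l] last_descents[of p l] that l by auto
  have inj: "inj_on (\<lambda>vs. (set vs, cycle_edges vs)) ((#) 0 ` descents k)"
  proof (rule inj_onI)
    fix xs ys :: "nat list"
    assume "xs \<in> (#) 0 ` descents k" "ys \<in> (#) 0 ` descents k"
      and "(set xs, cycle_edges xs) = (set ys, cycle_edges ys)"
    then obtain p q where pq: "xs = 0 # p" "ys = 0 # q" "p \<in> descents k" "q \<in> descents k"
      and eq: "set xs = set ys" "cycle_edges xs = cycle_edges ys" by auto
    have "distinct xs" "distinct ys"
      using pq set_descents distinct_descents by fastforce+
    moreover from this have "length xs = length ys"
      using eq by (metis distinct_card)
    moreover have "2 \<le> length xs"
      using length_descents[OF pq(3)] assms pq by simp
    \<comment> \<open>All sequences leave the hub into the last layer and return from the first;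
      these layers differ since \<open>k \<ge> 2\<close>, so no sequence reverses another.\<close>
    moreover have "xs ! 1 \<noteq> last ys"
      using hd[OF pq(3)] hd[OF pq(4)] last[OF pq(4)] pq l by (auto simp: hd_conv_nth)
    ultimately show "xs = ys"
      using eq pq by (intro cycle_edges_inj) auto
  qed
  have "card ((#) 0 ` descents k) \<le> num_cycles (hub_ladder k r)"
  proof (rule card_le_num_cycles[OF fin_simple_graph_hub_ladder inj])
    fix vs assume "vs \<in> (#) 0 ` descents k"
    then obtain p where p: "vs = 0 # p" "p \<in> descents k" by auto
    have "cycle_edges (0 # p) \<subseteq> edges (hub_ladder k r)"
    proof (rule cycle_edges_Cons_subset)
      show "successively (\<lambda>x y. {x, y} \<in> edges (hub_ladder k r)) p"
        using successively_descents[OF p(2)]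
        by (rule successively_mono) (auto simp: hub_ladder_def)
      show "{0, last p} \<in> edges (hub_ladder k r)"
        using last[OF p(2)] ladder_first_layer[of l] l by (auto simp: hub_ladder_def)
      show "{0, hd p} \<in> edges (hub_ladder k r)"
        using hd[OF p(2)] by (auto simp: hub_ladder_def)
    qed (use hd[OF p(2)] in simp)
    then show "distinct vs \<and> 3 \<le> length vs \<and> set vs \<subseteq> verts (hub_ladder k r) \<and>
        cycle_edges vs \<subseteq> edges (hub_ladder k r)"
      using set_descents[OF p(2)] distinct_descents[OF p(2)] length_descents[OF p(2)] assms p(1)
      by (auto simp: hub_ladder_def)
  qed (use assms in simp)
  then show ?thesis by (simp add: card_image)
qed

section \<open>Numerical estimates\<close>

text \<open>The initial factor 4 in \<open>card_descents_ge\<close> thus pays for up to four edges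
  beyond a multiple of 5. The reason is \<open>5^4 = 625 \<le> 1024 = 4^5\<close>.\<close>

lemma powr_four_fifths_le: "(2 + sqrt 8) powr (4 / 5) \<le> 4"
proof -
  have "sqrt 8 \<le> 3" by (rule real_le_lsqrt) auto
  then have "(2 + sqrt 8) powr (4 / 5) \<le> 5 powr (4 / 5)"
    by (intro powr_mono2) auto
  also have "\<dots> = (5 ^ 4) powr (1 / 5)"
    using powr_powr[of "5::real" 4 "1 / 5"] by simp
  also have "\<dots> \<le> (4 ^ 5) powr (1 / 5)"
    by (intro powr_mono2) auto
  also have "\<dots> = 4"
    by (simp add: powr_powr flip: powr_numeral)
  finally show ?thesis .
qed

text \<open>The ratio \<open>c\<close> of the two growth rates per edge exceeds 1, so
  \<open>c ^ m\<close> eventually absorbs the factor \<open>2 + sqrt 8\<close> lost to the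
  \<open>- 1\<close> in the exponent.\<close>

lemma eventually_power_le:
  "\<exists>M. \<forall>m\<ge>M. (1.37::real) ^ m \<le> (2 + sqrt 8) powr (real m / 5 - 1)"
proof -
  have pos: "0 < 2 + sqrt 8" by (simp add: add_pos_nonneg)
  define c where "c = (2 + sqrt 8) powr (1 / 5) / 1.37"
  \<comment> \<open>The margin is narrow: \<open>1.37 ^ 5\<close> is about 4.8262, just below 2 +
    2.8283.\<close>
  have "2.8283 \<le> sqrt 8" by (rule real_le_rsqrt) (simp add: power2_eq_square)
  then have "(1.37 ^ 5) powr (1 / 5) < (2 + sqrt 8) powr (1 / 5)"
    by (intro powr_less_mono2) (auto simp: eval_nat_numeral)
  moreover have "(1.37 ^ 5) powr (1 / 5) = (1.37 :: real)"
    by (simp add: powr_powr flip: powr_numeral)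
  ultimately have c: "1 < c" by (simp add: c_def)
  then obtain M where M: "2 + sqrt 8 < c ^ M" using real_arch_pow by blast
  have "1.37 ^ m \<le> (2 + sqrt 8) powr (real m / 5 - 1)" if "M \<le> m" for m
  proof -
    have "2 + sqrt 8 \<le> c ^ m"
      using M power_increasing[OF that, of c] c by linarith
    also have "\<dots> = (2 + sqrt 8) powr (real m / 5) / 1.37 ^ m"
      using pos by (simp add: c_def power_divide powr_power)
    finally have "(2 + sqrt 8) * 1.37 ^ m \<le> (2 + sqrt 8) powr (real m / 5)"
      by (simp add: pos_le_divide_eq)
    then show ?thesis
      using pos by (simp add: powr_diff pos_le_divide_eq mult.commute)
  qed
  then show ?thesis by blast
qed

section \<open>Choice of the graph for a given number of edges\<close>

theorem mainTheorem4:
  "\<exists>M::nat. \<forall>m\<ge>M.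
     (\<exists>G :: nat graph. fin_simple_graph G \<and> card (edges G) = m \<and>
        real (num_cycles G) \<ge> (2 + sqrt 8) powr (real m / 5 - 1) \<and>
        (2 + sqrt 8) powr (real m / 5 - 1) \<ge> (1.37::real) ^ m)"
proof -
  obtain M where M: "\<And>m. M \<le> m \<Longrightarrow> (1.37::real) ^ m \<le> (2 + sqrt 8) powr (real m / 5 - 1)"
    using eventually_power_le by blast
  have "\<exists>G :: nat graph. fin_simple_graph G \<and> card (edges G) = m \<and>
      (2 + sqrt 8) powr (real m / 5 - 1) \<le> real (num_cycles G)" if "10 \<le> m" for m
  proof -
    \<comment> \<open>The graph has \<open>m div 5\<close> layers and \<open>m mod 5\<close> pendant
      edges; \<open>10 \<le> m\<close> gives the two layers that the cycle count requires.\<close>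
    have "2 \<le> m div 5" using div_le_mono[OF that, of 5] by simp
    then obtain l where l: "m div 5 = Suc l" "0 < l"
      by (cases "m div 5") auto
    have m: "m = 5 * Suc l + m mod 5"
      using l(1) by (metis mult_div_mod_eq)
    have "m mod 5 \<le> 4" using pos_mod_bound[of 5 m] by linarith
    \<comment> \<open>The left side equals \<open>l + (m mod 5) / 5\<close>: the \<open>- 1\<close>
      matches the shift from \<open>Suc l\<close> layers to the power \<open>l\<close>.\<close>
    then have "real m / 5 - 1 \<le> real l + 4 / 5"
      by (subst m) (simp add: field_simps)
    then have "(2 + sqrt 8) powr (real m / 5 - 1) \<le> (2 + sqrt 8) powr (real l + 4 / 5)"
      by (intro powr_mono) auto
    also have "\<dots> = (2 + sqrt 8) powr (4 / 5) * (2 + sqrt 8) ^ l"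
      by (simp add: powr_add powr_realpow add_pos_nonneg)
    also have "\<dots> \<le> 4 * (2 + sqrt 8) ^ l"
      by (intro mult_right_mono powr_four_fifths_le) auto
    also have "\<dots> \<le> real (card (descents (Suc l)))"
      by (rule card_descents_ge)
    also have "\<dots> \<le> real (num_cycles (hub_ladder (Suc l) (m mod 5)))"
      using num_cycles_hub_ladder[of "Suc l"] l by simp
    finally show ?thesis
      using fin_simple_graph_hub_ladder[of "Suc l" "m mod 5"]
        card_edges_hub_ladder[of "Suc l" "m mod 5"] l m by (metis Suc_leI numeral_2_eq_2 Suc_le_mono zero_less_Suc)
  qed
  with M have "\<forall>m\<ge>max M 10. \<exists>G :: nat graph. fin_simple_graph G \<and> card (edges G) = m \<and>
      real (num_cycles G) \<ge> (2 + sqrt 8) powr (real m / 5 - 1) \<and>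
      (2 + sqrt 8) powr (real m / 5 - 1) \<ge> (1.37::real) ^ m"
    by (metis max.bounded_iff)
  then show ?thesis by blast
qed

end
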